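(* For any large enough $n$ and $\varepsilon=\Omega(1/n)$, there exist $b\in\mathbb{R}^n$ and $t\in[n]$ such that the following holds. Every randomized algorithm that, given access to an invertible SDD matrix $S\in\mathbb{R}^{n\times n}$ whose spectral gap is $\Omega(1)$, succeeds with probability at least $3/4$ to approximate $x^{\ast}(t)$ within absolute error $\varepsilon\|x^{\ast}\|_\infty$, where $x^{\ast}=S^{-1}b$, must probe $\Omega(1/\varepsilon)$ coordinates of $S$ in the worst case.
   Context: A matrix $S$ is SDD if it is symmetric, has positive diagonal, and $S(j,j)\ge\sum_{k\ne j}|S(j,k)|$ for all $j$. Its spectral gap is half the smallest nonzero eigenvalue of $D_S^{-1/2}SD_S^{-1/2}$, where $D_S$ is the diagonal part of $S$.
   Formalization: The formal statement adds the condition ε < 1; for ε ≥ 1 the claim fails, since the constant output 0 is within ε‖x*‖∞ of x*(t) with no probes. *)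

theory Defs
  imports
    "HOL-Probability.Probability_Measure"
    "Jordan_Normal_Form.Gauss_Jordan_Elimination"
    "Jordan_Normal_Form.Spectral_Radius"
begin

definition SDD :: "real mat \<Rightarrow> bool" where
  "SDD S \<longleftrightarrow> square_mat S \<and> transpose_mat S = S \<and>
     (\<forall>j<dim_row S. S $$ (j, j) > 0) \<and>
     (\<forall>j<dim_row S. S $$ (j, j) \<ge> (\<Sum>k\<in>{..<dim_row S} - {j}. \<bar>S $$ (j, k)\<bar>))"

definition normalized_mat :: "real mat \<Rightarrow> real mat" where
  "normalized_mat S =
     (let D = mat_diag (dim_row S) (\<lambda>i. 1 / sqrt (S $$ (i, i))) in D * S * D)"

definition spectral_gap :: "real mat \<Rightarrow> real" where
  "spectral_gap S = Min (spectrum (normalized_mat S) - {0}) / 2"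

definition sdd_inputs :: "nat \<Rightarrow> real \<Rightarrow> real mat set" where
  "sdd_inputs n \<gamma> =
     {S \<in> carrier_mat n n. SDD S \<and> invertible_mat S \<and> spectral_gap S \<ge> \<gamma>}"

definition linear_solution :: "real mat \<Rightarrow> real vec \<Rightarrow> real vec" where
  "linear_solution S b = the (mat_inverse S) *\<^sub>v b"

definition linf_norm :: "real vec \<Rightarrow> real" where
  "linf_norm x = Max ((\<lambda>i. \<bar>vec_index x i\<bar>) ` {..<dim_vec x})"

text \<open>A deterministic adaptive algorithm is a decision tree: a probe of entry \<open>(i, j)\<close>
  continues with the subtree selected by the value read. Computation between probes is free.\<close>

datatype probe_tree = Output real | Probe nat nat "real \<Rightarrow> probe_tree"

primrec tree_output :: "real mat \<Rightarrow> probe_tree \<Rightarrow> real" where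
  "tree_output S (Output r) = r"
| "tree_output S (Probe i j f) = tree_output S (f (S $$ (i, j)))"

primrec probed :: "real mat \<Rightarrow> probe_tree \<Rightarrow> (nat \<times> nat) set" where
  "probed S (Output r) = {}"
| "probed S (Probe i j f) = insert (i, j) (probed S (f (S $$ (i, j))))"

text \<open>A randomized algorithm is a probability distribution over deterministic ones. The
  \<open>\<sigma>\<close>-algebra is arbitrary, as long as the output and the number of probed coordinates are
  random variables on every input; so any source of randomness is covered, by push-forward.\<close>

definition randomized_algorithm :: "nat \<Rightarrow> probe_tree measure \<Rightarrow> bool" where
  "randomized_algorithm n R \<longleftrightarrow> prob_space R \<and>
     (\<forall>S\<in>carrier_mat n n.
        (\<forall>T\<in>space R. probed S T \<subseteq> {..<n} \<times> {..<n}) \<and>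
        (\<lambda>T. tree_output S T) \<in> borel_measurable R \<and>
        (\<lambda>T. card (probed S T)) \<in> measurable R (count_space UNIV))"

end

theory Submission
  imports Defs
begin

text \<open>The coordinate \<open>t = 0\<close> is linked to one hidden coordinate \<open>k\<close> by an off-diagonal entry
  \<open>\<plusminus>1/4\<close>, the rest of the matrix being diagonal. The right-hand side vanishes at \<open>t\<close> and the
  weights are chosen so that \<open>x(t) = \<plusminus>\<parallel>x\<parallel>\<^sub>\<infinity>\<close>; hence for every \<open>\<epsilon> < 1\<close> a correct output reveals
  the sign of the link. An algorithm that, run on the unlinked matrix, does not probe \<open>(t, k)\<close> or
  \<open>(k, t)\<close> cannot be correct for both signs at \<open>k\<close>. For each \<open>k\<close> both answers are correct with
  probability at least \<open>1/2\<close>, so on average about \<open>n/2\<close> of the links have to be probed, and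
  \<open>n\<close> is at least of order \<open>1/\<epsilon>\<close>.\<close>

unbundle no vec_syntax

section \<open>Decision trees\<close>

lemma finite_probed: "finite (probed S T)"
  by (induction T) auto

text \<open>Each answer read on \<open>S\<close> recurs on \<open>S'\<close>, so by induction both
  runs follow the same branch; adaptivity does not matter.\<close>

lemma tree_output_cong:
  assumes "\<And>i j. (i, j) \<in> probed S T \<Longrightarrow> S' $$ (i, j) = S $$ (i, j)"
  shows "tree_output S' T = tree_output S T"
  using assms by (induction T) auto

section \<open>Linear systems\<close>

text \<open>Invertibility ensures that \<open>mat_inverse\<close> is not \<open>None\<close>; its
  value \<open>C\<close> is a left inverse, so applying \<open>C\<close> to \<open>S x = b\<close>
  returns \<open>x\<close>. A solution can thus be guessed and then verified.\<close>

lemma linear_solution_eqI: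
  assumes S: "S \<in> carrier_mat n n" and "invertible_mat S"
    and x: "x \<in> carrier_vec n" and eq: "S *\<^sub>v x = b"
  shows "linear_solution S b = x"
proof -
  obtain B where B: "inverts_mat S B" "inverts_mat B S"
    using assms(2) unfolding invertible_mat_def by blast
  have SB: "S * B = 1\<^sub>m n" using B(1) S by (auto simp: inverts_mat_def)
  have BS': "B * S = 1\<^sub>m (dim_row B)" using B(2) by (auto simp: inverts_mat_def)
  \<comment> \<open>\<open>inverts_mat\<close> leaves the shape of \<open>B\<close> open; the two
    products determine it.\<close>
  have dc: "dim_col B = n" by (metis SB index_mult_mat(3) index_one_mat(3))
  have dr: "dim_row B = n" by (metis BS' S carrier_matD(2) index_mult_mat(3) index_one_mat(3))
  have Bc: "B \<in> carrier_mat n n" using dc dr by auto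
  have BS: "B * S = 1\<^sub>m n" using BS' dr by simp
  have "S \<in> Units (ring_mat TYPE(real) n ())"
    unfolding Units_def using S Bc BS SB by (auto simp: ring_mat_def)
  then obtain C where C: "mat_inverse S = Some C"
    using mat_inverse(1)[OF S, where b = "()"] by (cases "mat_inverse S") auto
  have CS: "C * S = 1\<^sub>m n" and Cc: "C \<in> carrier_mat n n"
    using mat_inverse(2)[OF S C] by auto
  have "C *\<^sub>v b = (C * S) *\<^sub>v x"
    unfolding eq[symmetric] using Cc S x by simp
  then show ?thesis
    unfolding linear_solution_def C using CS x by simp
qed

section \<open>The hidden link\<close>

text \<open>The parameters \<open>a\<close> and \<open>d\<close> are kept general so that the family
  is closed under normalization. At \<open>d = 0\<close> the matrix no longer depends on
  \<open>k\<close>.\<close>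

definition linked_mat :: "nat \<Rightarrow> nat \<Rightarrow> real \<Rightarrow> real \<Rightarrow> real mat" where
  "linked_mat n k a d = mat n n (\<lambda>(i, j).
     if i = j then (if i = 0 then a else 1)
     else if (i, j) = (0, k) \<or> (i, j) = (k, 0) then d else 0)"

lemma linked_mat_carrier [simp]:
  "linked_mat n k a d \<in> carrier_mat n n"
  "dim_row (linked_mat n k a d) = n" "dim_col (linked_mat n k a d) = n"
  by (simp_all add: linked_mat_def)

lemma linked_mat_index:
  "i < n \<Longrightarrow> j < n \<Longrightarrow> linked_mat n k a d $$ (i, j) =
     (if i = j then (if i = 0 then a else 1)
      else if (i, j) = (0, k) \<or> (i, j) = (k, 0) then d else 0)"
  by (simp add: linked_mat_def)

lemma linked_mat_mult_vec:
  assumes "v \<in> carrier_vec n" "0 < k" "k < n" "i < n"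
  shows "(linked_mat n k a d *\<^sub>v v) $ i =
    (if i = 0 then a * v $ 0 + d * v $ k else if i = k then d * v $ 0 + v $ k else v $ i)"
proof -
  have "(linked_mat n k a d *\<^sub>v v) $ i = (\<Sum>j = 0..<n. linked_mat n k a d $$ (i, j) * v $ j)"
    using assms by (simp add: scalar_prod_def)
  also have "\<dots> = (\<Sum>j\<in>{i, 0, k}. linked_mat n k a d $$ (i, j) * v $ j)"
    using assms by (intro sum.mono_neutral_right) (auto simp: linked_mat_index)
  also have "\<dots> = (if i = 0 then a * v $ 0 + d * v $ k
      else if i = k then d * v $ 0 + v $ k else v $ i)"
  proof -
    \<comment> \<open>The support \<open>{i, 0, k}\<close> loses an element when \<open>i\<close> is
      \<open>0\<close> or \<open>k\<close>.\<close>
    consider "i = 0" | "i = k" | "i \<noteq> 0" "i \<noteq> k" by blast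
    then show ?thesis
    proof cases
      case 1
      then have "{i, 0, k} = {0, k}" by auto
      then show ?thesis using 1 assms by (simp add: linked_mat_index)
    next
      case 2
      then have "{i, 0, k} = {0, k}" by auto
      then show ?thesis using 2 assms by (simp add: linked_mat_index)
    next
      case 3
      then show ?thesis using assms by (simp add: linked_mat_index)
    qed
  qed
  finally show ?thesis .
qed

lemma linked_mat_SDD:
  assumes "0 < k" "k < n" "0 < a" "\<bar>d\<bar> \<le> a" "\<bar>d\<bar> \<le> 1"
  shows "SDD (linked_mat n k a d)"
proof -
  have "(\<Sum>l\<in>{..<n} - {j}. \<bar>linked_mat n k a d $$ (j, l)\<bar>) \<le> linked_mat n k a d $$ (j, j)"
    if "j < n" for j
  proof -
    have "(\<Sum>l\<in>{..<n} - {j}. \<bar>linked_mat n k a d $$ (j, l)\<bar>)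
        = (\<Sum>l\<in>{0, k} - {j}. \<bar>linked_mat n k a d $$ (j, l)\<bar>)"
      using assms that by (intro sum.mono_neutral_right) (auto simp: linked_mat_index)
    also have "\<dots> \<le> linked_mat n k a d $$ (j, j)"
    proof -
      consider "j = 0" | "j = k" | "j \<noteq> 0" "j \<noteq> k" by blast
      then show ?thesis
      proof cases
        case 1
        then have "{0, k} - {j} = {k}" using assms by auto
        then show ?thesis using 1 assms by (simp add: linked_mat_index)
      next
        case 2
        then have "{0, k} - {j} = {0}" using assms by auto
        then show ?thesis using 2 assms by (simp add: linked_mat_index)
      next
        case 3
        then have "{0, k} - {j} = {0, k}" by auto
        then show ?thesis using 3 that assms by (simp add: linked_mat_index)
      qed
    qed
    finally show ?thesis .
  qed
  moreover have "transpose_mat (linked_mat n k a d) = linked_mat n k a d"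
    by (intro eq_matI) (auto simp: linked_mat_index)
  ultimately show ?thesis
    using assms by (auto simp: SDD_def linked_mat_index)
qed

text \<open>Coordinates \<open>0\<close> and \<open>k\<close> span a block with rows
  \<open>(a, d)\<close> and \<open>(d, 1)\<close>, of determinant \<open>a - d\<^sup>2\<close>; the
  identity acts on the rest. So the kernel is trivial.\<close>

lemma linked_mat_invertible:
  assumes "0 < k" "k < n" and det: "a \<noteq> d\<^sup>2"
  shows "invertible_mat (linked_mat n k a d)"
proof -
  let ?A = "linked_mat n k a d"
  have "v = 0\<^sub>v n" if v: "v \<in> carrier_vec n" and eq: "?A *\<^sub>v v = 0\<^sub>v n" for v
  proof -
    have e: "(if i = 0 then a * v $ 0 + d * v $ k else if i = k then d * v $ 0 + v $ k else v $ i) = 0"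
      if "i < n" for i
      using linked_mat_mult_vec[OF v assms(1,2) that, of a d] that unfolding eq by simp
    have 1: "a * v $ 0 + d * v $ k = 0" "v $ k = - d * v $ 0"
      using e[of 0] e[of k] assms by auto
    then have "(a - d\<^sup>2) * v $ 0 = 0" by (simp add: algebra_simps power2_eq_square)
    then have "v $ 0 = 0" "v $ k = 0" using det 1 by auto
    then have "v $ i = 0" if "i < n" for i using e[OF that] by (auto split: if_splits)
    then show ?thesis using v by (intro eq_vecI) auto
  qed
  then have "det ?A \<noteq> 0"
    using det_0_iff_vec_prod_zero[of ?A n] by auto
  then have "?A \<in> Units (ring_mat TYPE(real) n ())"
    by (intro det_non_zero_imp_unit) simp_all
  then show ?thesis
    by (auto simp: Units_def ring_mat_def invertible_mat_def inverts_mat_def)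
qed

section \<open>Normalization, spectrum and spectral gap\<close>

lemma normalized_linked_mat:
  assumes "0 < k" "0 < a"
  shows "normalized_mat (linked_mat n k a d) = linked_mat n k 1 (d / sqrt a)"
proof -
  let ?A = "linked_mat n k a d"
  let ?f = "\<lambda>i. 1 / sqrt (?A $$ (i, i))"
  have "mat_diag n ?f * ?A * mat_diag n ?f
      = mat n n (\<lambda>(i, j). ?f i * ?A $$ (i, j) * ?f j)"
    by (subst mat_diag_mult_left[of _ n n], simp, subst mat_diag_mult_right[of _ n n], simp)
       auto
  also have "\<dots> = linked_mat n k 1 (d / sqrt a)"
    using assms by (intro eq_matI) (auto simp: linked_mat_index)
  finally show ?thesis by (simp add: normalized_mat_def Let_def)
qed

text \<open>The block on \<open>0\<close> and \<open>k\<close> has eigenvalues \<open>1 - d\<close>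
  and \<open>1 + d\<close>; every other coordinate contributes \<open>1\<close>.\<close>

lemma spectrum_linked_mat:
  assumes "0 < k" "k < n"
  shows "spectrum (linked_mat n k 1 d) \<subseteq> {1, 1 - d, 1 + d}"
proof
  fix l assume "l \<in> spectrum (linked_mat n k 1 d)"
  then obtain v where v: "v \<in> carrier_vec n" "v \<noteq> 0\<^sub>v n"
    and eq: "linked_mat n k 1 d *\<^sub>v v = l \<cdot>\<^sub>v v"
    by (auto simp: spectrum_def eigenvalue_def eigenvector_def)
  have e: "(if i = 0 then 1 * v $ 0 + d * v $ k else if i = k then d * v $ 0 + v $ k else v $ i)
      = l * v $ i" if "i < n" for i
    using linked_mat_mult_vec[OF v(1) assms that, of 1 d] that v unfolding eq by simp
  have 1: "(l - 1) * v $ 0 = d * v $ k" "(l - 1) * v $ k = d * v $ 0"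
    using e[of 0] e[of k] assms by (auto simp: algebra_simps)
  show "l \<in> {1, 1 - d, 1 + d}"
  proof (rule ccontr)
    assume l: "l \<notin> {1, 1 - d, 1 + d}"
    \<comment> \<open>The left factor is the determinant of the block shifted by \<open>l\<close>,
      nonzero by assumption.\<close>
    have "(l - 1 - d) * (l - 1 + d) * v $ 0 = (l - 1) * ((l - 1) * v $ 0) - d * (d * v $ 0)"
      by (simp add: algebra_simps)
    also have "\<dots> = 0" unfolding 1(1) 1(2)[symmetric] by simp
    finally have "v $ 0 = 0" using l by auto
    then have "v $ k = 0" using 1 l by auto
    then have "v $ i = 0" if "i < n" for i
      using e[OF that] l \<open>v $ 0 = 0\<close> by (auto split: if_splits)
    then have "v = 0\<^sub>v n" using v(1) by (intro eq_vecI) auto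
    then show False using v(2) by simp
  qed
qed

text \<open>The \<open>Min\<close> in \<open>spectral_gap\<close> is only meaningful on a nonempty
  set, so an eigenvalue is exhibited: \<open>3 \<le> n\<close> leaves a coordinate outside the link,
  and its unit vector is an eigenvector.\<close>

lemma one_in_spectrum_linked_mat:
  assumes "0 < k" "k < n" "3 \<le> n"
  shows "1 \<in> spectrum (linked_mat n k 1 d)"
proof -
  obtain j where j: "j < n" "j \<noteq> 0" "j \<noteq> k"
    using assms that[of 1] that[of 2] by (cases "k = 1") auto
  let ?v = "unit_vec n j :: real vec"
  have "linked_mat n k 1 d *\<^sub>v ?v = 1 \<cdot>\<^sub>v ?v"
  proof (intro eq_vecI)
    fix i assume "i < dim_vec (1 \<cdot>\<^sub>v ?v)"
    then have "i < n" by simp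
    then show "(linked_mat n k 1 d *\<^sub>v ?v) $ i = (1 \<cdot>\<^sub>v ?v) $ i"
      using j assms by (subst linked_mat_mult_vec) auto
  qed simp
  then show ?thesis
    using j by (auto simp: spectrum_def eigenvalue_def eigenvector_def intro!: exI[of _ ?v])
qed

text \<open>Normalizing the diagonal entry \<open>1/4\<close> doubles the link, so the eigenvalues
  are at least \<open>1 - 2 * \<bar>d\<bar> \<ge> 1/2\<close>, and the gap is half of that. The
  range of \<open>d\<close> covers both signs of the link and the unlinked matrix.\<close>

lemma linked_mat_in_sdd_inputs:
  assumes k: "0 < k" "k < n" and n: "3 \<le> n" and d: "\<bar>d\<bar> \<le> 1 / 4"
  shows "linked_mat n k (1/4) d \<in> sdd_inputs n (1/4)"
proof -
  let ?E = "spectrum (linked_mat n k 1 (2 * d)) - {0}"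
  have "normalized_mat (linked_mat n k (1/4) d) = linked_mat n k 1 (2 * d)"
    using normalized_linked_mat[OF k(1), of "1/4" n d] by (simp add: real_sqrt_divide mult.commute)
  then have gap: "spectral_gap (linked_mat n k (1/4) d) = Min ?E / 2"
    by (simp add: spectral_gap_def)
  have sub: "?E \<subseteq> {1, 1 - 2 * d, 1 + 2 * d}"
    using spectrum_linked_mat[OF k, of "2 * d"] by blast
  have "1 \<in> ?E"
    using one_in_spectrum_linked_mat[OF k n] by simp
  then have ne: "?E \<noteq> {}" by blast
  have "finite ?E" using finite_subset[OF sub] by simp
  from Min_in[OF this ne] have "Min ?E \<in> {1, 1 - 2 * d, 1 + 2 * d}"
    using sub by (rule subsetD[rotated])
  then have "Min ?E \<ge> 1/2" using d by (elim insertE) auto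
  then have "spectral_gap (linked_mat n k (1/4) d) \<ge> 1/4" unfolding gap by simp
  moreover have "d\<^sup>2 \<le> (1/4)\<^sup>2" using d by (metis abs_ge_zero power2_abs power_mono)
  then have "1/4 \<noteq> d\<^sup>2" by (auto simp: power2_eq_square)
  ultimately show ?thesis
    using assms by (auto simp: sdd_inputs_def intro!: linked_mat_SDD linked_mat_invertible)
qed

section \<open>Right-hand side and solution of the linked systems\<close>

definition hidden_rhs :: "nat \<Rightarrow> real vec" where
  "hidden_rhs n = vec n (\<lambda>i. if i = 0 then 0 else 1)"

text \<open>Row \<open>0\<close> gives \<open>x $ 0 = s * x $ k\<close>; row \<open>k\<close> then
  gives \<open>(1 - 1/4) * x $ k = 1\<close>, hence the value \<open>4/3\<close>, which exceeds the
  remaining entries \<open>1\<close>. The right-hand side does not depend on \<open>k\<close> or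
  \<open>s\<close>, so it can be fixed in advance.\<close>

lemma linear_solution_linked_mat:
  assumes k: "0 < k" "k < n" and n: "3 \<le> n" and s: "s \<in> {1, -1}"
  defines "x \<equiv> linear_solution (linked_mat n k (1/4) (- s / 4)) (hidden_rhs n)"
  shows "x $ 0 = s * (4/3)" and "linf_norm x = 4/3"
proof -
  let ?x = "vec n (\<lambda>i. if i = 0 then s * (4/3) else if i = k then 4/3 else 1) :: real vec"
  have d: "\<bar>- s / 4\<bar> \<le> 1/4" using s by auto
  have x: "x = ?x"
    unfolding x_def
  proof (rule linear_solution_eqI)
    show "invertible_mat (linked_mat n k (1/4) (- s / 4))"
      using linked_mat_in_sdd_inputs[OF k n d] by (simp add: sdd_inputs_def)
    show "linked_mat n k (1/4) (- s / 4) *\<^sub>v ?x = hidden_rhs n"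
    proof (intro eq_vecI)
      fix i assume "i < dim_vec (hidden_rhs n)"
      then have "i < n" by (simp add: hidden_rhs_def)
      then show "(linked_mat n k (1/4) (- s / 4) *\<^sub>v ?x) $ i = hidden_rhs n $ i"
        using k s by (subst linked_mat_mult_vec) (auto simp: hidden_rhs_def)
    qed (simp add: hidden_rhs_def)
  qed simp_all
  show "x $ 0 = s * (4/3)" using x n by simp
  show "linf_norm x = 4/3"
    unfolding linf_norm_def x
  proof (rule Max_eqI)
    show "4/3 \<in> (\<lambda>i. \<bar>?x $ i\<bar>) ` {..<dim_vec ?x}"
      using k by (intro image_eqI[of _ _ k]) auto
  qed (use s in auto)
qed

section \<open>The lower bound\<close>

text \<open>A pair with a zero component determines the other component as \<open>i + j\<close>, so
  one probe accounts for at most one \<open>k\<close>.\<close>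

lemma card_links_le:
  assumes "finite P"
  shows "card {k \<in> K. (0, k) \<in> P \<or> (k, 0) \<in> P} \<le> card (P :: (nat \<times> nat) set)"
proof -
  have "{k \<in> K. (0, k) \<in> P \<or> (k, 0) \<in> P} \<subseteq> (\<lambda>(i, j). i + j) ` P"
    by force
  then show ?thesis using assms by (meson card_image_le card_mono finite_imageI le_trans)
qed

lemma (in prob_space) prob_Int_ge:
  assumes "A \<in> events" "B \<in> events"
  shows "prob (A \<inter> B) \<ge> prob A + prob B - 1"
proof -
  have "prob (A \<union> B) + prob (A \<inter> B) = prob A + prob B"
    using assms by (simp add: measure_Un3 fmeasurable_eq_sets)
  then show ?thesis using prob_le_1[of "A \<union> B"] by linarith
qed

text \<open>The sum is the expected number of events that occur, by linearity of expectation; no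
  independence is involved.\<close>

lemma (in prob_space) sum_prob_le_AE_card:
  assumes "finite K" and ev: "\<And>k. k \<in> K \<Longrightarrow> A k \<in> events"
    and AE: "AE x in M. real (card {k \<in> K. x \<in> A k}) \<le> q"
  shows "(\<Sum>k\<in>K. prob (A k)) \<le> q"
proof -
  have int: "integrable M (indicator (A k) :: _ \<Rightarrow> real)" if "k \<in> K" for k
    using ev[OF that] by (simp add: integrable_indicator_iff emeasure_eq_measure)
  have "(\<Sum>k\<in>K. prob (A k)) = (\<Sum>k\<in>K. expectation (indicator (A k)))"
    using ev by (intro sum.cong) auto
  also have "\<dots> = expectation (\<lambda>x. \<Sum>k\<in>K. indicator (A k) x)"
    using int by (subst Bochner_Integration.integral_sum) auto
  also have "\<dots> \<le> q"
  proof (rule integral_le_const)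
    show "AE x in M. (\<Sum>k\<in>K. indicator (A k) x) \<le> q"
      using AE
    proof eventually_elim
      case (elim x)
      have "(\<Sum>k\<in>K. indicator (A k) x :: real) = real (card {k \<in> K. x \<in> A k})"
        using \<open>finite K\<close> by (simp add: indicator_def sum.If_cases Int_def)
      then show ?case using elim by simp
    qed
  qed (use int in auto)
  finally show ?thesis .
qed

text \<open>If the run on the unlinked matrix misses the link at \<open>k\<close>, the output is the
  same for both signs, but the targets \<open>4/3\<close> and \<open>-4/3\<close> are too far apart
  for a tolerance below \<open>4/3\<close>. The index \<open>1\<close> in the unlinked matrix is
  arbitrary.\<close>

lemma few_correct_links:
  fixes \<epsilon> :: real
  assumes n: "3 \<le> n" and \<epsilon>: "\<epsilon> < 1"
    and rng: "probed (linked_mat n 1 (1/4) 0) T \<subseteq> {..<n} \<times> {..<n}"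
  defines "correct \<equiv> \<lambda>k s. let x = linear_solution (linked_mat n k (1/4) (- s / 4)) (hidden_rhs n)
    in \<bar>tree_output (linked_mat n k (1/4) (- s / 4)) T - x $ 0\<bar> \<le> \<epsilon> * linf_norm x"
  shows "card {k \<in> {1..<n}. correct k 1 \<and> correct k (- 1)}
    \<le> card (probed (linked_mat n 1 (1/4) 0) T)"
proof -
  let ?S = "linked_mat n 1 (1/4) 0" and ?A = "\<lambda>k s. linked_mat n k (1/4) (- s / 4)"
  let ?P = "probed ?S T"
  have "(0, k) \<in> ?P \<or> (k, 0) \<in> ?P" if k: "0 < k" "k < n" and c: "correct k 1" "correct k (- 1)" for k
  proof (rule ccontr)
    assume hid: "\<not> ((0, k) \<in> ?P \<or> (k, 0) \<in> ?P)"
    have eq: "tree_output (?A k s) T = tree_output ?S T" for s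
    proof (rule tree_output_cong)
      \<comment> \<open>The range condition \<open>rng\<close> is what makes
        \<open>linked_mat_index\<close> applicable.\<close>
      fix i j assume "(i, j) \<in> ?P"
      then have "i < n" "j < n" "(i, j) \<noteq> (0, k)" "(i, j) \<noteq> (k, 0)"
        using hid rng by (blast, blast, metis, metis)
      then show "?A k s $$ (i, j) = ?S $$ (i, j)"
        by (auto simp: linked_mat_index)
    qed
    have "\<bar>tree_output ?S T - s * (4/3)\<bar> \<le> \<epsilon> * (4/3)"
      if "correct k s" "s \<in> {1, -1}" for s
      using that(1) unfolding correct_def Let_def eq linear_solution_linked_mat[OF k n that(2)] .
    from this[OF c(1)] this[OF c(2)]
    have "\<bar>tree_output ?S T - 1 * (4/3)\<bar> \<le> \<epsilon> * (4/3)"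
      "\<bar>tree_output ?S T - (- 1) * (4/3)\<bar> \<le> \<epsilon> * (4/3)"
      by blast+
    then show False using \<epsilon> by linarith
  qed
  then have "{k \<in> {1..<n}. correct k 1 \<and> correct k (- 1)}
      \<subseteq> {k \<in> {1..<n}. (0, k) \<in> ?P \<or> (k, 0) \<in> ?P}"
    by (auto simp: Suc_le_eq)
  then have "card {k \<in> {1..<n}. correct k 1 \<and> correct k (- 1)}
      \<le> card {k \<in> {1..<n}. (0, k) \<in> ?P \<or> (k, 0) \<in> ?P}"
    by (intro card_mono) auto
  also have "\<dots> \<le> card ?P"
    using finite_probed by (rule card_links_le)
  finally show ?thesis .
qed

lemma probe_lower_bound:
  fixes \<epsilon> q :: real
  assumes n: "3 \<le> n" and \<epsilon>: "\<epsilon> < 1" and q: "q \<le> real n / 4"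
    and alg: "randomized_algorithm n R"
    and correct: "\<And>S. S \<in> sdd_inputs n (1/4) \<Longrightarrow>
      measure R {T \<in> space R. \<bar>tree_output S T - linear_solution S (hidden_rhs n) $ 0\<bar>
        \<le> \<epsilon> * linf_norm (linear_solution S (hidden_rhs n))} \<ge> 3 / 4"
  shows "measure R {T \<in> space R. real (card (probed (linked_mat n 1 (1/4) 0) T)) \<ge> q} > 0"
proof (rule ccontr)
  let ?S = "linked_mat n 1 (1/4) 0" and ?A = "\<lambda>k s. linked_mat n k (1/4) (- s / 4)"
  let ?C = "\<lambda>k s. {T \<in> space R. \<bar>tree_output (?A k s) T - linear_solution (?A k s) (hidden_rhs n) $ 0\<bar>
    \<le> \<epsilon> * linf_norm (linear_solution (?A k s) (hidden_rhs n))}"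
  let ?Q = "{T \<in> space R. real (card (probed ?S T)) \<ge> q}"
  interpret prob_space R using alg by (simp add: randomized_algorithm_def)
  have rng: "probed ?S T \<subseteq> {..<n} \<times> {..<n}" if "T \<in> space R" for T
    using alg that by (auto simp: randomized_algorithm_def)
  have [measurable]: "(\<lambda>T. card (probed ?S T)) \<in> measurable R (count_space UNIV)"
    "\<And>k s. (\<lambda>T. tree_output (?A k s) T) \<in> borel_measurable R"
    using alg by (auto simp: randomized_algorithm_def)
  have C: "?C k s \<in> events" for k s by measurable
  have Q: "?Q \<in> events" by measurable
  assume "\<not> ?thesis"
  then have "prob ?Q = 0" using measure_nonneg[of R ?Q] by linarith
  then have "?Q \<in> null_sets R" using Q by (simp add: emeasure_eq_measure null_setsI)
  then have "AE T in R. T \<notin> ?Q" by (rule AE_not_in)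
  \<comment> \<open>Almost surely fewer than \<open>q\<close> probes are made on the unlinked
    matrix, which bounds the number of \<open>k\<close> answered correctly for both signs.\<close>
  then have AE: "AE T in R. real (card {k \<in> {1..<n}. T \<in> ?C k 1 \<inter> ?C k (- 1)}) \<le> q"
    using AE_space
  proof eventually_elim
    case (elim T)
    then have "real (card (probed ?S T)) < q" by simp
    moreover have "card {k \<in> {1..<n}. T \<in> ?C k 1 \<inter> ?C k (- 1)} \<le> card (probed ?S T)"
      using few_correct_links[OF n \<epsilon> rng[OF elim(2)]] elim(2) by (simp add: Let_def)
    ultimately show ?case by linarith
  qed
  \<comment> \<open>Each sign fails with probability at most \<open>1/4\<close>.\<close>
  have "prob (?C k 1 \<inter> ?C k (- 1)) \<ge> 1/2" if "k \<in> {1..<n}" for k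
  proof -
    have "prob (?C k s) \<ge> 3/4" if "\<bar>s\<bar> = 1" for s
      using \<open>k \<in> {1..<n}\<close> n that by (intro correct linked_mat_in_sdd_inputs) auto
    from this[of 1] this[of "- 1"] prob_Int_ge[OF C C, of k 1 k "- 1"] show ?thesis
      by simp
  qed
  then have "(\<Sum>k\<in>{1..<n}. 1/2) \<le> (\<Sum>k\<in>{1..<n}. prob (?C k 1 \<inter> ?C k (- 1)))"
    by (rule sum_mono)
  also have "\<dots> \<le> q"
    by (rule sum_prob_le_AE_card[OF _ sets.Int[OF C C] AE]) simp
  \<comment> \<open>The sum is \<open>(n - 1) / 2\<close>, which exceeds \<open>n / 4\<close> once
    \<open>n \<ge> 3\<close>.\<close>
  finally show False using q n by simp
qed

text \<open>The worst case is expressed by an input on which the probe count is reached with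
  positive probability. For \<open>\<epsilon> \<ge> 1\<close> the constant output \<open>0\<close>
  is always accurate enough, without any probe; hence the bound
  \<open>\<epsilon> < 1\<close>.\<close>

theorem theorem1p11:
  shows "\<exists>\<gamma>>0. \<forall>c>0. \<exists>c'>0. \<exists>n\<^sub>0. \<forall>n\<ge>n\<^sub>0. \<forall>\<epsilon>::real.
    c / real n \<le> \<epsilon> \<and> \<epsilon> < 1 \<longrightarrow>
    (\<exists>b\<in>carrier_vec n. \<exists>t<n. \<forall>R. randomized_algorithm n R \<longrightarrow>
      (\<forall>S\<in>sdd_inputs n \<gamma>.
         measure R {T \<in> space R.
           \<bar>tree_output S T - vec_index (linear_solution S b) t\<bar>
             \<le> \<epsilon> * linf_norm (linear_solution S b)} \<ge> 3 / 4) \<longrightarrow>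
      (\<exists>S\<in>sdd_inputs n \<gamma>.
         measure R {T \<in> space R. real (card (probed S T)) \<ge> c' / \<epsilon>} > 0))"
proof (rule exI[of _ "1/4"], intro conjI allI impI)
  fix c :: real assume c: "c > 0"
  show "\<exists>c'>0. \<exists>n\<^sub>0. \<forall>n\<ge>n\<^sub>0. \<forall>\<epsilon>::real. c / real n \<le> \<epsilon> \<and> \<epsilon> < 1 \<longrightarrow>
    (\<exists>b\<in>carrier_vec n. \<exists>t<n. \<forall>R. randomized_algorithm n R \<longrightarrow>
      (\<forall>S\<in>sdd_inputs n (1/4).
         measure R {T \<in> space R.
           \<bar>tree_output S T - vec_index (linear_solution S b) t\<bar>
             \<le> \<epsilon> * linf_norm (linear_solution S b)} \<ge> 3 / 4) \<longrightarrow>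
      (\<exists>S\<in>sdd_inputs n (1/4).
         measure R {T \<in> space R. real (card (probed S T)) \<ge> c' / \<epsilon>} > 0))"
  \<comment> \<open>With \<open>c' = c / 4\<close>, the condition
    \<open>c / n \<le> \<epsilon>\<close> turns the target \<open>c' / \<epsilon>\<close> into at
    most \<open>n / 4\<close>, the threshold of \<open>probe_lower_bound\<close>.\<close>
  proof (rule exI[of _ "c / 4"], intro conjI exI[of _ "3::nat"] allI impI)
    fix n :: nat and \<epsilon> :: real
    assume n: "3 \<le> n" and \<epsilon>: "c / real n \<le> \<epsilon> \<and> \<epsilon> < 1"
    have "0 < c / real n" using c n by simp
    then have "0 < \<epsilon>" using \<epsilon> by linarith
    moreover have "c \<le> \<epsilon> * real n" using \<epsilon> n by (simp add: divide_le_eq)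
    ultimately have q: "c / 4 / \<epsilon> \<le> real n / 4" by (simp add: divide_le_eq mult.commute)
    show "\<exists>b\<in>carrier_vec n. \<exists>t<n. \<forall>R. randomized_algorithm n R \<longrightarrow>
      (\<forall>S\<in>sdd_inputs n (1/4).
         measure R {T \<in> space R.
           \<bar>tree_output S T - vec_index (linear_solution S b) t\<bar>
             \<le> \<epsilon> * linf_norm (linear_solution S b)} \<ge> 3 / 4) \<longrightarrow>
      (\<exists>S\<in>sdd_inputs n (1/4).
         measure R {T \<in> space R. real (card (probed S T)) \<ge> c / 4 / \<epsilon>} > 0)"
    proof (intro bexI[of _ "hidden_rhs n"] exI[of _ "0::nat"] conjI allI impI)
      fix R assume "randomized_algorithm n R"
        and "\<forall>S\<in>sdd_inputs n (1/4). measure R {T \<in> space R.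
           \<bar>tree_output S T - linear_solution S (hidden_rhs n) $ 0\<bar>
             \<le> \<epsilon> * linf_norm (linear_solution S (hidden_rhs n))} \<ge> 3 / 4"
      then have "measure R {T \<in> space R.
          real (card (probed (linked_mat n 1 (1/4) 0) T)) \<ge> c / 4 / \<epsilon>} > 0"
        using n \<epsilon> q by (intro probe_lower_bound[where \<epsilon> = \<epsilon>]) blast+
      moreover have "linked_mat n 1 (1/4) 0 \<in> sdd_inputs n (1/4)"
        using n by (intro linked_mat_in_sdd_inputs) auto
      ultimately show "\<exists>S\<in>sdd_inputs n (1/4).
         measure R {T \<in> space R. real (card (probed S T)) \<ge> c / 4 / \<epsilon>} > 0"
        by blast
    qed (use n in \<open>auto simp: hidden_rhs_def\<close>)
  qed (use c in simp)
qed simp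

end
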